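(* Let $k\in\mathbb{N}_0$, $a\in\mathbb{C}\setminus\{0,-1,-2,\ldots\}$ and $m\in\mathbb{N}_0$. The analytic continuation of $s\mapsto H_k(-1,s,a)$ to $s=-m$ satisfies $$H_k(-1,-m,a)=\frac12\alpha_kE_{m+2}(a)+\frac12(\beta_k-2a\alpha_k)E_{m+1}(a)+\frac12(1-a\beta_k+a^2\alpha_k)E_m(a).$$
   Context: $\mathbb{N}_0=\{0,1,2,\ldots\}$. $\alpha_k=\frac32 4^k$, $\beta_k=\frac32 2^k$, and the $k$-augmented centered triangular numbers are given by $A(r+1,k)=\alpha_k r^2+\beta_k r+1$ for integers $r\ge0$. Complex powers are principal: $(r+a)^{-s}=\exp\{-s\operatorname{Log}(r+a)\}$, $-\pi<\operatorname{Arg}\le\pi$. $H_k(-1,s,a)=\sum_{r=0}^{\infty}\frac{A(r+1,k)(-1)^r}{(r+a)^s}$, which converges for $\operatorname{Re}(s)>2$ (absolutely for $\operatorname{Re}(s)>3$); the continuation is analytic continuation in the variable $s$ from this half-plane to $\mathbb{C}$. The Euler polynomials $E_n(a)$ are defined by $\frac{2e^{at}}{e^t+1}=\sum_{n=0}^\infty E_n(a)\frac{t^n}{n!}$, $|t|<\pi$. *)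

theory Defs
  imports "HOL-Complex_Analysis.Complex_Analysis"
begin

definition alpha :: "nat \<Rightarrow> complex" where
  "alpha k = 3 / 2 * 4 ^ k"

definition beta :: "nat \<Rightarrow> complex" where
  "beta k = 3 / 2 * 2 ^ k"

text \<open>
  The \<open>k\<close>-augmented centered triangular numbers, normalised so that
  \<open>A (r + 1) k = alpha k * r\<^sup>2 + beta k * r + 1\<close>; the index \<open>n = 0\<close> is never used.
\<close>
definition A :: "nat \<Rightarrow> nat \<Rightarrow> complex" where
  "A n k = alpha k * of_nat (n - 1) ^ 2 + beta k * of_nat (n - 1) + 1"

lemma A_Suc: "A (r + 1) k = alpha k * of_nat r ^ 2 + beta k * of_nat r + 1"
  by (simp add: A_def)

text \<open>
  Complex \<open>powr\<close> is the principal power: \<open>w powr s = exp (s * Ln w)\<close> for \<open>w \<noteq> 0\<close>,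
  where \<open>-pi < Im (Ln w) \<le> pi\<close>. The base is nonzero when \<open>a\<close> is not a nonpositive integer.
\<close>
definition H_term :: "nat \<Rightarrow> complex \<Rightarrow> complex \<Rightarrow> nat \<Rightarrow> complex" where
  "H_term k s a r = A (r + 1) k * (-1) ^ r / (of_nat r + a) powr s"

definition is_H_continuation :: "nat \<Rightarrow> complex \<Rightarrow> (complex \<Rightarrow> complex) \<Rightarrow> bool" where
  "is_H_continuation k a F \<longleftrightarrow>
     F holomorphic_on UNIV \<and> (\<forall>s. Re s > 2 \<longrightarrow> H_term k s a sums F s)"

text \<open>The function \<open>s \<mapsto> H\<^sub>k(-1, s, a)\<close> after analytic continuation in \<open>s\<close>.\<close>
definition H :: "nat \<Rightarrow> complex \<Rightarrow> complex \<Rightarrow> complex" where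
  "H k s a = (THE F. is_H_continuation k a F) s"

lemma is_H_continuation_unique:
  assumes "is_H_continuation k a F" "is_H_continuation k a G"
  shows "F = G"
proof
  fix s
  have "F s = G s"
  proof (rule analytic_continuation_open[of "{s. Re s > 2}" UNIV F G])
    show "open {s. Re s > 2}" by (rule open_halfspace_Re_gt)
    show "{s. Re s > 2} \<noteq> {}" by (auto intro!: exI[of _ 3])
    show "F z = G z" if "z \<in> {s. Re s > 2}" for z
      using assms that unfolding is_H_continuation_def by (auto intro: sums_unique2)
  qed (use assms in \<open>auto simp: is_H_continuation_def\<close>)
  then show "F s = G s" .
qed

text \<open>The Euler polynomials, defined by their exponential generating function.\<close>
definition is_euler_poly :: "(nat \<Rightarrow> complex \<Rightarrow> complex) \<Rightarrow> bool" where
  "is_euler_poly E \<longleftrightarrow>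
     (\<forall>a t. norm t < pi \<longrightarrow>
        (\<lambda>n. E n a * (t ^ n / fact n)) sums (2 * exp (a * t) / (exp t + 1)))"

definition euler_poly :: "nat \<Rightarrow> complex \<Rightarrow> complex" where
  "euler_poly = (THE E. is_euler_poly E)"

lemma exp_plus_1_nonzero:
  assumes "norm (t::complex) < pi"
  shows "exp t + 1 \<noteq> 0"
proof
  assume "exp t + 1 = 0"
  then have "exp t = -1" by (simp add: eq_neg_iff_add_eq_0)
  then have "exp t = exp (\<i> * of_real pi)" by simp
  then obtain n :: int where n: "t = \<i> * of_real pi + of_int (2 * n) * of_real pi * \<i>"
    unfolding exp_eq by auto
  have "Im t = (1 + 2 * of_int n) * pi" unfolding n by (simp add: algebra_simps)
  then have "\<bar>Im t\<bar> = \<bar>of_int (1 + 2 * n)\<bar> * pi" by (simp add: abs_mult)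
  moreover have "\<bar>1 + 2 * n\<bar> \<ge> 1" by presburger
  then have "\<bar>of_int (1 + 2 * n) :: real\<bar> \<ge> 1" by linarith
  ultimately have "\<bar>Im t\<bar> \<ge> pi" by simp
  with abs_Im_le_cmod[of t] assms show False by linarith
qed

lemma ex1_euler_poly: "\<exists>!E. is_euler_poly E"
proof (rule ex_ex1I)
  let ?E = "\<lambda>n a. (deriv ^^ n) (\<lambda>t::complex. 2 * exp (a * t) / (exp t + 1)) 0"
  have "is_euler_poly ?E"
    unfolding is_euler_poly_def
  proof (intro allI impI)
    fix a t :: complex assume t: "norm t < pi"
    have "(\<lambda>t. 2 * exp (a * t) / (exp t + 1)) holomorphic_on ball 0 pi"
      by (intro holomorphic_intros exp_plus_1_nonzero) auto
    from holomorphic_power_series[OF this, of t] t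
    show "(\<lambda>n. ?E n a * (t ^ n / fact n)) sums (2 * exp (a * t) / (exp t + 1))"
      by simp
  qed
  then show "\<exists>E. is_euler_poly E" by blast
next
  fix E E' assume E: "is_euler_poly E" and E': "is_euler_poly E'"
  show "E = E'"
  proof (intro ext)
    fix m a
    define d where "d n = (E n a - E' n a) / fact n" for n
    have d: "(\<lambda>n. d n * t ^ n) sums 0" if "norm t < pi" for t
      using sums_diff[OF E[unfolded is_euler_poly_def, rule_format, OF that, of a]
          E'[unfolded is_euler_poly_def, rule_format, OF that, of a]]
      by (simp add: d_def field_simps)
    have "d m = 0"
    proof (rule ccontr)
      assume "d m \<noteq> 0"
      show False
      proof (cases "m = 0")
        case True
        have "d 0 = 0"
          by (rule sums_unique2[OF powser_sums_zero d]) simp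
        with True \<open>d m \<noteq> 0\<close> show False by simp
      next
        case False
        show False
        proof (rule powser_0_nonzero[of pi 0 d "\<lambda>_. 0" m])
          show "(\<lambda>n. d n * (x - 0) ^ n) sums 0" if "norm (x - 0) < pi" for x
            using d[of x] that by simp
          show False if "0 < s" "\<And>z::complex. z \<in> cball 0 s - {0} \<Longrightarrow> (0::complex) \<noteq> 0" for s
            using that(2)[of "of_real s"] that(1) by simp
        qed (use \<open>d m \<noteq> 0\<close> False in simp_all)
      qed
    qed
    then show "E m a = E' m a" by (simp add: d_def)
  qed
qed

lemma euler_poly_sums:
  assumes "norm t < pi"
  shows "(\<lambda>n. euler_poly n a * (t ^ n / fact n)) sums (2 * exp (a * t) / (exp t + 1))"
  using theI'[OF ex1_euler_poly] assms unfolding euler_poly_def is_euler_poly_def by blast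

end

theory Submission
  imports Defs
begin

text \<open>
  Expanding the quadratic \<open>A (r + 1) k\<close> in powers of \<open>r + a\<close> instead of \<open>r\<close> gives the coefficients
  \<open>alpha k\<close>, \<open>beta k - 2 * a * alpha k\<close> and \<open>1 - a * beta k + a\<^sup>2 * alpha k\<close>, so the series is a
  combination of the alternating Hurwitz zeta function
  \<open>\<eta> a s = (\<Sum>r. (-1) ^ r * (r + a) powr (- s))\<close> at \<open>s - 2\<close>, \<open>s - 1\<close> and \<open>s\<close>
  (\<open>H_term_decomposition\<close>). Everything thus follows from two facts: \<open>\<eta> a\<close> extends to an entire
  function, and this function takes the value \<open>E\<^sub>m(a) / 2\<close> at \<open>- m\<close>.

  Both come from Euler's transformation of alternating series. Let \<open>\<Delta> f z = f z - f (z + 1)\<close>.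
  Pairing neighbours rewrites \<open>\<Sum>r. (-1) ^ r * f (a + r)\<close> as
  \<open>f a / 2 + (\<Sum>r. (-1) ^ r * \<Delta> f (a + r)) / 2\<close>, and after \<open>N\<close> rounds as
  \<open>(\<Sum>j<N. (\<Delta> ^^ j) f a / 2 ^ Suc j) + (\<Sum>r. (-1) ^ r * (\<Delta> ^^ N) f (a + r)) / 2 ^ N\<close>.
  For \<open>f z = z powr (- s)\<close> each difference gains a factor \<open>1 / z\<close>
  (\<open>norm_decrement_pow_powr_le\<close>), so the last series converges locally uniformly for
  \<open>Re s > 1 - N\<close>. The expressions for different \<open>N\<close> agree where they are defined
  (\<open>eta_stage_eq\<close>) and glue to an entire function.

  At \<open>s = - m\<close> the function \<open>f\<close> is the polynomial \<open>z ^ m\<close>, whose differences of order above \<open>m\<close>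
  vanish; the sum that remains is the Neumann series for half of the inverse of \<open>1 - \<Delta> / 2\<close>, applied to
  \<open>z ^ m\<close>. The equation \<open>E\<^sub>m(z) + E\<^sub>m(z + 1) = 2 * z ^ m\<close> says that \<open>(1 - \<Delta> / 2) E\<^sub>m\<close> is \<open>z ^ m\<close>, so the
  sum is \<open>E\<^sub>m(a) / 2\<close> (\<open>alt_hurwitz_neg_nat\<close>).
\<close>

section \<open>Iterated unit differences\<close>

text \<open>
  The sign is opposite to the usual forward difference: in an alternating series it is this
  difference that arises when a term is paired with its successor.
\<close>

definition decrement :: "(complex \<Rightarrow> complex) \<Rightarrow> complex \<Rightarrow> complex" where
  "decrement f z = f z - f (z + 1)"

lemma decrement_pow_Suc:
  "(decrement ^^ Suc N) f z = (decrement ^^ N) f z - (decrement ^^ N) f (z + 1)"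
  by (simp add: decrement_def)

lemma decrement_pow_cmult:
  "(decrement ^^ N) (\<lambda>z. c * f z) z = c * (decrement ^^ N) f z"
  by (induction N arbitrary: z) (simp_all add: decrement_def algebra_simps)

lemma decrement_pow_diff:
  "(decrement ^^ N) (\<lambda>z. f z - g z) z = (decrement ^^ N) f z - (decrement ^^ N) g z"
  by (induction N arbitrary: z) (simp_all add: decrement_def algebra_simps)

text \<open>
  The iterated difference at \<open>z\<close> samples \<open>f\<close> only at the points \<open>z + i\<close>. This allows replacing
  \<open>z powr m\<close> by \<open>z ^ m\<close> under the difference although the two differ at \<open>0\<close> when \<open>m = 0\<close>.
\<close>

lemma decrement_pow_cong:
  assumes "\<And>i::nat. f (z + of_nat i) = g (z + of_nat i)"
  shows "(decrement ^^ N) f z = (decrement ^^ N) g z"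
  using assms
proof (induction N arbitrary: z)
  case 0
  from this[of 0] show ?case by simp
next
  case (Suc N)
  have "f (z + 1 + of_nat i) = g (z + 1 + of_nat i)" for i
    using Suc.prems[of "Suc i"] by (simp add: add_ac)
  from Suc.IH[OF this] Suc.IH[OF Suc.prems] show ?case
    by (simp only: decrement_pow_Suc)
qed

lemma holomorphic_decrement_pow:
  assumes "\<And>i::nat. (\<lambda>s. f s (z + of_nat i)) holomorphic_on S"
  shows "(\<lambda>s. (decrement ^^ N) (f s) z) holomorphic_on S"
  using assms
proof (induction N arbitrary: z)
  case 0
  from this[of 0] show ?case by simp
next
  case (Suc N)
  have "(\<lambda>s. f s (z + 1 + of_nat i)) holomorphic_on S" for i
    using Suc.prems[of "Suc i"] by (simp add: add_ac)
  from Suc.IH[OF this] Suc.IH[OF Suc.prems] show ?case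
    unfolding decrement_pow_Suc by (intro holomorphic_intros)
qed

lemma has_field_derivative_decrement_pow:
  assumes "\<And>z. Re z > 0 \<Longrightarrow> (f has_field_derivative f' z) (at z)" "Re z > 0"
  shows "((decrement ^^ N) f has_field_derivative (decrement ^^ N) f' z) (at z)"
  using assms(2)
proof (induction N arbitrary: z)
  case 0
  then show ?case using assms(1) by simp
next
  case (Suc N)
  have "((\<lambda>z. (decrement ^^ N) f (z + 1)) has_field_derivative (decrement ^^ N) f' (z + 1)) (at z)"
    by (rule DERIV_shift[THEN iffD1], rule Suc.IH) (use Suc.prems in simp)
  with Suc.IH[OF Suc.prems] show ?case
    unfolding decrement_pow_Suc by (intro DERIV_diff)
qed

text \<open>
  Since \<open>z powr (- s)\<close> has derivative \<open>- s * z powr (- (s + 1))\<close>, the mean value inequality trades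
  one difference at \<open>s\<close> for a factor \<open>s\<close> and the bound at \<open>s + 1\<close>. Iterating turns the factors into
  \<open>pochhammer s N\<close>. The exponential accounts for the argument of \<open>z\<close>; the hypothesis on \<open>Re s + N\<close>
  makes the bound decrease along the unit segment from \<open>z\<close>, so that its left end is the worst point.
\<close>

lemma norm_decrement_pow_powr_le:
  assumes "Re z > 0" "Re s + real N \<ge> 0"
  shows "norm ((decrement ^^ N) (\<lambda>z. z powr (- s)) z)
           \<le> norm (pochhammer s N) * exp (pi * \<bar>Im s\<bar>) * Re z powr (- Re s - real N)"
  using assms
proof (induction N arbitrary: s z)
  case 0
  have "Im s * Arg z \<le> \<bar>Im s\<bar> * \<bar>Arg z\<bar>" by (metis abs_ge_self abs_mult)
  also have "\<dots> \<le> \<bar>Im s\<bar> * pi"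
    using Arg_bounded[of z] by (intro mult_left_mono) auto
  finally have "exp (Im s * Arg z) \<le> exp (pi * \<bar>Im s\<bar>)" by (simp add: mult.commute)
  moreover have "norm z powr (- Re s) \<le> Re z powr (- Re s)"
    using 0 complex_Re_le_cmod[of z] by (intro powr_mono2') auto
  ultimately have "norm z powr (- Re s) * exp (Im s * Arg z) \<le> Re z powr (- Re s) * exp (pi * \<bar>Im s\<bar>)"
    by (intro mult_mono) auto
  then show ?case by (simp add: norm_powr_complex mult.commute)
next
  case (Suc N)
  define B where "B = norm (pochhammer s (Suc N)) * exp (pi * \<bar>Im s\<bar>) * Re z powr (- Re s - real (Suc N))"
  have "norm ((decrement ^^ N) (\<lambda>z. z powr (- s)) z - (decrement ^^ N) (\<lambda>z. z powr (- s)) (z + 1))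
          \<le> B * norm (z - (z + 1))"
  proof (rule field_differentiable_bound)
    show "convex (closed_segment z (z + 1))" by simp
    fix w assume w: "w \<in> closed_segment z (z + 1)"
    then obtain u where u: "0 \<le> u" "w = z + of_real u"
      by (auto simp: closed_segment_def scaleR_conv_of_real algebra_simps)
    have Re_w: "Re w > 0" "Re z \<le> Re w" using u Suc.prems by auto
    show "((decrement ^^ N) (\<lambda>z. z powr (- s)) has_field_derivative
             (decrement ^^ N) (\<lambda>z. (- s) * z powr (- (s + 1))) w) (at w within closed_segment z (z + 1))"
    proof (rule DERIV_subset[OF has_field_derivative_decrement_pow])
      fix z :: complex assume "Re z > 0"
      then have "z \<notin> \<real>\<^sub>\<le>\<^sub>0" by (auto simp: complex_nonpos_Reals_iff)
      from has_field_derivative_powr[OF this, of "- s"]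
      show "((\<lambda>z. z powr (- s)) has_field_derivative (- s) * z powr (- (s + 1))) (at z)"
        by (simp only: minus_add_distrib) simp
    qed (use Re_w in auto)
    have exponent: "- Re (s + 1) - real N = - Re s - real (Suc N)" by simp
    have "norm ((decrement ^^ N) (\<lambda>z. z powr (- (s + 1))) w) \<le>
            norm (pochhammer (s + 1) N) * exp (pi * \<bar>Im (s + 1)\<bar>) * Re w powr (- Re (s + 1) - real N)"
      by (rule Suc.IH) (use Suc.prems Re_w in auto)
    also have "\<dots> = norm (pochhammer (s + 1) N) * exp (pi * \<bar>Im s\<bar>) * Re w powr (- Re s - real (Suc N))"
      unfolding exponent by simp
    also have "\<dots> \<le> norm (pochhammer (s + 1) N) * exp (pi * \<bar>Im s\<bar>) * Re z powr (- Re s - real (Suc N))"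
      using Suc.prems Re_w by (intro mult_left_mono powr_mono2') auto
    finally have "norm s * norm ((decrement ^^ N) (\<lambda>z. z powr (- (s + 1))) w) \<le>
       norm s * (norm (pochhammer (s + 1) N) * exp (pi * \<bar>Im s\<bar>) * Re z powr (- Re s - real (Suc N)))"
      by (rule mult_left_mono) simp
    then show "norm ((decrement ^^ N) (\<lambda>z. (- s) * z powr (- (s + 1))) w) \<le> B"
      unfolding decrement_pow_cmult by (simp add: B_def pochhammer_rec norm_mult mult_ac)
  qed auto
  then show ?case by (simp only: decrement_pow_Suc) (simp add: B_def)
qed

section \<open>Euler's transformation of alternating series\<close>

text \<open>
  The two partial sums differ by the boundary terms \<open>g 0\<close> and \<open>\<plusminus> g n\<close>; as \<open>g n\<close> tends to \<open>0\<close>, the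
  original series converges, even if only conditionally, as soon as the differenced series does.
\<close>

lemma sums_alternating_Euler:
  fixes g :: "nat \<Rightarrow> complex"
  assumes "g \<longlonglongrightarrow> 0" "(\<lambda>r. (-1) ^ r * (g r - g (Suc r))) sums T"
  shows "(\<lambda>r. (-1) ^ r * g r) sums ((g 0 + T) / 2)"
proof -
  have partial: "(\<Sum>r<n. (-1) ^ r * g r) =
      (g 0 + (\<Sum>r<n. (-1) ^ r * (g r - g (Suc r))) - (-1) ^ n * g n) / 2" for n
    by (induction n) (simp_all add: field_simps)
  have "(\<lambda>n. norm ((-1) ^ n * g n)) \<longlonglongrightarrow> 0"
    using tendsto_norm[OF assms(1)] by (simp add: norm_mult norm_power)
  then have "(\<lambda>n. (-1) ^ n * g n) \<longlonglongrightarrow> 0" by (rule tendsto_norm_zero_cancel)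
  moreover have "(\<lambda>n. \<Sum>r<n. (-1) ^ r * (g r - g (Suc r))) \<longlonglongrightarrow> T"
    using assms(2) by (simp add: sums_def)
  ultimately have "(\<lambda>n. (g 0 + (\<Sum>r<n. (-1) ^ r * (g r - g (Suc r))) - (-1) ^ n * g n) / 2)
      \<longlonglongrightarrow> (g 0 + T - 0) / 2"
    by (intro tendsto_intros) auto
  then show ?thesis unfolding sums_def partial by simp
qed

text \<open>
  The convention \<open>0 powr s = 0\<close> makes every summand an entire function of \<open>s\<close>, whatever \<open>a\<close> is.
\<close>

definition eta_term :: "complex \<Rightarrow> nat \<Rightarrow> complex \<Rightarrow> nat \<Rightarrow> complex" where
  "eta_term a N s r = (-1) ^ r * (decrement ^^ N) (\<lambda>z. z powr (- s)) (of_nat r + a)"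

text \<open>
  The outcome of \<open>N\<close> rounds of Euler's transformation. It is meaningful for \<open>Re s > - N\<close>, where the
  remaining series converges, and that series converges absolutely for \<open>Re s > 1 - N\<close>.
\<close>

definition eta_stage :: "complex \<Rightarrow> nat \<Rightarrow> complex \<Rightarrow> complex" where
  "eta_stage a N s = (\<Sum>j<N. (decrement ^^ j) (\<lambda>z. z powr (- s)) a / 2 ^ Suc j)
                     + (\<Sum>r. eta_term a N s r) / 2 ^ N"

lemma holomorphic_eta_term: "(\<lambda>s. eta_term a N s r) holomorphic_on S"
  unfolding eta_term_def by (intro holomorphic_intros holomorphic_decrement_pow)

lemma eta_term_tendsto_0:
  assumes "Re s + real N > 0"
  shows "(\<lambda>r. (decrement ^^ N) (\<lambda>z. z powr (- s)) (of_nat r + a)) \<longlonglongrightarrow> 0"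
proof (rule Lim_null_comparison)
  show "\<forall>\<^sub>F r in sequentially. norm ((decrement ^^ N) (\<lambda>z. z powr (- s)) (of_nat r + a))
     \<le> norm (pochhammer s N) * exp (pi * \<bar>Im s\<bar>) * (real r + Re a) powr (- Re s - real N)"
    using eventually_gt_at_top[of "nat \<lceil>- Re a\<rceil>"]
  proof eventually_elim
    case (elim r)
    then have "real r + Re a > 0" by linarith
    then show ?case
      using norm_decrement_pow_powr_le[of "of_nat r + a" s N] assms by simp
  qed
  have "filterlim (\<lambda>r. real r + Re a) at_top sequentially"
    by (rule filterlim_tendsto_add_at_top[of "\<lambda>_. Re a", simplified add.commute[of "Re a"]])
       (auto intro: filterlim_real_sequentially)
  then have "(\<lambda>r. (real r + Re a) powr (- Re s - real N)) \<longlonglongrightarrow> 0"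
    using assms by (intro tendsto_neg_powr) auto
  from tendsto_mult_right_zero[OF this]
  show "(\<lambda>r. norm (pochhammer s N) * exp (pi * \<bar>Im s\<bar>) * (real r + Re a) powr (- Re s - real N)) \<longlonglongrightarrow> 0"
    by simp
qed

text \<open>
  Half of the distance of \<open>s0\<close> from the line \<open>Re s = 1 - N\<close> is spent on the radius \<open>d\<close> of the
  neighbourhood and half on the summable majorant \<open>r powr (- (1 + d))\<close>. For large \<open>r\<close> the real part
  \<open>r + Re a\<close> of the base is at least \<open>r / 2\<close>, which removes the dependence on \<open>a\<close>.
\<close>

lemma eta_term_locally_dominated:
  assumes s0: "Re s0 + real N > 1"
  shows "\<exists>d h. 0 < d \<and> summable h \<and>
    (\<forall>\<^sub>F r in sequentially. \<forall>s\<in>ball s0 d \<inter> {s. Re s + real N > 1}. norm (eta_term a N s r) \<le> h r)"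
proof -
  define d where "d = (Re s0 + real N - 1) / 2"
  have d: "d > 0" using s0 by (simp add: d_def)
  have "continuous_on (cball s0 d) (\<lambda>s. pochhammer s N)"
    unfolding pochhammer_prod by (intro continuous_intros)
  then have "compact ((\<lambda>s. pochhammer s N) ` cball s0 d)"
    using compact_cball by (rule compact_continuous_image)
  then have "bounded ((\<lambda>s. pochhammer s N) ` cball s0 d)" by (rule compact_imp_bounded)
  then obtain B where B: "B > 0" "\<And>s. s \<in> cball s0 d \<Longrightarrow> norm (pochhammer s N) \<le> B"
    unfolding bounded_pos by blast
  define K where "K = B * exp (pi * (\<bar>Im s0\<bar> + d))"
  define h where "h r = K * (real r / 2) powr (- (1 + d))" for r
  have "(\<lambda>r. K * (1 / 2) powr (- (1 + d)) * (real r powr (- (1 + d)))) = h"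
    by (rule ext) (simp add: h_def powr_mult[symmetric] mult.assoc)
  moreover have "summable (\<lambda>r. K * (1 / 2) powr (- (1 + d)) * (real r powr (- (1 + d))))"
    using d by (intro summable_mult) (simp add: summable_real_powr_iff)
  ultimately have "summable h" by simp
  moreover have "\<forall>\<^sub>F r in sequentially. \<forall>s\<in>ball s0 d \<inter> {s. Re s + real N > 1}. norm (eta_term a N s r) \<le> h r"
    using eventually_ge_at_top[of "nat \<lceil>2 * \<bar>Re a\<bar>\<rceil> + 2"]
  proof eventually_elim
    case (elim r)
    then have r: "real r \<ge> 2 * \<bar>Re a\<bar> + 2" by linarith
    show ?case
    proof
      fix s assume s: "s \<in> ball s0 d \<inter> {s. Re s + real N > 1}"
      then have dist: "norm (s - s0) < d" by (simp add: dist_norm norm_minus_commute)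
      have Re_s: "Re s + real N \<ge> 1 + d"
        using abs_Re_le_cmod[of "s - s0"] dist by (simp add: d_def field_simps)
      have Im_s: "\<bar>Im s\<bar> \<le> \<bar>Im s0\<bar> + d"
        using abs_Im_le_cmod[of "s - s0"] dist by simp
      have "norm (eta_term a N s r) \<le>
          norm (pochhammer s N) * exp (pi * \<bar>Im s\<bar>) * (real r + Re a) powr (- Re s - real N)"
        using norm_decrement_pow_powr_le[of "of_nat r + a" s N] r Re_s d
        by (simp add: eta_term_def norm_mult norm_power)
      also have "\<dots> \<le> B * exp (pi * (\<bar>Im s0\<bar> + d)) * (real r / 2) powr (- (1 + d))"
      proof (intro mult_mono)
        show "norm (pochhammer s N) \<le> B" using s by (intro B) auto
        have "(real r + Re a) powr (- Re s - real N) \<le> (real r + Re a) powr (- (1 + d))"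
          using r Re_s by (intro powr_mono) auto
        also have "\<dots> \<le> (real r / 2) powr (- (1 + d))"
          using r d by (intro powr_mono2') auto
        finally show "(real r + Re a) powr (- Re s - real N) \<le> (real r / 2) powr (- (1 + d))" .
      qed (use Im_s B in auto)
      finally show "norm (eta_term a N s r) \<le> h r" by (simp add: h_def K_def)
    qed
  qed
  ultimately show ?thesis using d by blast
qed

lemma eta_series:
  shows "\<And>s. Re s + real N > 1 \<Longrightarrow> summable (eta_term a N s)"
    and "(\<lambda>s. \<Sum>r. eta_term a N s r) holomorphic_on {s. Re s + real N > 1}"
proof -
  define S where "S = {s. Re s + real N > 1}"
  have S: "open S"
    using open_halfspace_Re_gt[of "1 - real N"] by (simp add: S_def algebra_simps)
  have "\<exists>g g'. \<forall>s \<in> S. ((\<lambda>r. eta_term a N s r) sums g s) \<and>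
      ((\<lambda>r. deriv (\<lambda>s. eta_term a N s r) s) sums g' s) \<and> (g has_field_derivative g' s) (at s)"
  proof (rule series_and_derivative_comparison_local[OF S])
    show "((\<lambda>s. eta_term a N s r) has_field_derivative deriv (\<lambda>s. eta_term a N s r) s) (at s)" for r s
      using holomorphic_derivI[OF holomorphic_eta_term open_UNIV, of s] by simp
  qed (use eta_term_locally_dominated in \<open>simp add: S_def\<close>)
  then obtain g g' where g: "\<And>s. s \<in> S \<Longrightarrow> eta_term a N s sums g s"
    and g': "\<And>s. s \<in> S \<Longrightarrow> (g has_field_derivative g' s) (at s)" by blast
  show "summable (eta_term a N s)" if "Re s + real N > 1" for s
    using g[of s] that by (auto simp: S_def sums_iff)
  have "g holomorphic_on S"
    using g' S by (auto simp: holomorphic_on_open)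
  then have "(\<lambda>s. \<Sum>r. eta_term a N s r) holomorphic_on S"
    by (rule holomorphic_transform) (use g in \<open>auto simp: sums_iff\<close>)
  then show "(\<lambda>s. \<Sum>r. eta_term a N s r) holomorphic_on {s. Re s + real N > 1}"
    by (simp add: S_def)
qed

text \<open>
  One round of the transformation enlarges the half-plane: the series of order \<open>N + 1\<close> converges
  absolutely for \<open>Re s > - N\<close>, and this yields conditional convergence of the series of order \<open>N\<close>
  on the strip \<open>- N < Re s \<le> 1 - N\<close>.
\<close>

lemma eta_term_Euler:
  assumes "Re s + real N > 0"
  shows "eta_term a N s sums
           (((decrement ^^ N) (\<lambda>z. z powr (- s)) a + (\<Sum>r. eta_term a (Suc N) s r)) / 2)"
proof -
  have "eta_term a (Suc N) s sums (\<Sum>r. eta_term a (Suc N) s r)"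
    using eta_series(1)[of s "Suc N"] assms by (simp add: summable_sums)
  then have "(\<lambda>r. (-1) ^ r * ((decrement ^^ N) (\<lambda>z. z powr (- s)) (of_nat r + a)
      - (decrement ^^ N) (\<lambda>z. z powr (- s)) (of_nat (Suc r) + a))) sums (\<Sum>r. eta_term a (Suc N) s r)"
    by (simp only: eta_term_def[abs_def] decrement_pow_Suc) (simp add: add_ac)
  from sums_alternating_Euler[OF eta_term_tendsto_0[OF assms] this] show ?thesis
    by (simp add: eta_term_def[abs_def])
qed

lemma eta_stage_Suc:
  assumes "Re s + real N > 0"
  shows "eta_stage a (Suc N) s = eta_stage a N s"
  unfolding eta_stage_def sums_unique[OF eta_term_Euler[OF assms, of a], symmetric]
  by (simp add: add_divide_distrib mult.commute)

lemma eta_stage_eq: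
  assumes "Re s + real N > 0" "Re s + real M > 0"
  shows "eta_stage a N s = eta_stage a M s"
proof -
  have "eta_stage a M s = eta_stage a N s" if "N \<le> M" "Re s + real N > 0" for N M
    using that(1)
  proof (induction M rule: dec_induct)
    case (step M)
    then show ?case using eta_stage_Suc[of s M a] that(2) by simp
  qed simp
  then show ?thesis using assms by (metis nle_le)
qed

section \<open>The alternating Hurwitz zeta function\<close>

text \<open>
  The number of rounds depends on \<open>s\<close> and is chosen so that \<open>Re s + N \<ge> 1\<close>. Any \<open>N\<close> with
  \<open>Re s + N > 0\<close> gives the same value, so a fixed \<open>N\<close> can be used near any given point.
\<close>

definition alt_hurwitz :: "complex \<Rightarrow> complex \<Rightarrow> complex" where
  "alt_hurwitz a s = eta_stage a (Suc (nat \<lceil>- Re s\<rceil>)) s"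

lemma alt_hurwitz_eq_eta_stage:
  assumes "Re s + real N > 0"
  shows "alt_hurwitz a s = eta_stage a N s"
  unfolding alt_hurwitz_def by (rule eta_stage_eq[OF _ assms]) linarith

lemma holomorphic_alt_hurwitz:
  "alt_hurwitz a holomorphic_on UNIV"
proof -
  have "alt_hurwitz a field_differentiable (at s)" for s
  proof -
    define N where "N = nat \<lceil>2 - Re s\<rceil>"
    define S where "S = {s. Re s + real N > 1}"
    have S: "open S"
      using open_halfspace_Re_gt[of "1 - real N"] by (simp add: S_def algebra_simps)
    have "s \<in> S" unfolding S_def N_def by simp linarith
    have "eta_stage a N holomorphic_on S"
      unfolding eta_stage_def S_def
      by (intro holomorphic_intros eta_series(2) holomorphic_decrement_pow) auto
    then have "alt_hurwitz a holomorphic_on S"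
      by (rule holomorphic_transform) (auto simp: S_def intro!: alt_hurwitz_eq_eta_stage[symmetric])
    then show ?thesis using S \<open>s \<in> S\<close> by (rule holomorphic_on_imp_differentiable_at)
  qed
  then show ?thesis by (simp add: holomorphic_on_def)
qed

text \<open>
  The terms are only conditionally summable for \<open>0 < Re s \<le> 1\<close>. This range matters: with \<open>s\<close>
  replaced by \<open>s - 2\<close> it supplies the convergence of the augmented series on all of \<open>Re s > 2\<close>.
\<close>

lemma alt_hurwitz_sums:
  assumes "Re s > 0"
  shows "(\<lambda>r. (-1) ^ r * (of_nat r + a) powr (- s)) sums alt_hurwitz a s"
proof -
  have "eta_term a 0 s sums (\<Sum>r. eta_term a 0 s r)"
    using eta_term_Euler[of s 0 a] assms by (simp add: sums_iff)
  moreover have "alt_hurwitz a s = (\<Sum>r. eta_term a 0 s r)"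
    using alt_hurwitz_eq_eta_stage[of s 0 a] assms by (simp add: eta_stage_def)
  ultimately show ?thesis by (simp add: eta_term_def[abs_def])
qed

section \<open>Euler polynomials\<close>

definition euler_fps :: "complex \<Rightarrow> complex fps" where
  "euler_fps a = Abs_fps (\<lambda>n. euler_poly n a / fact n)"

lemma euler_fps_mult: "euler_fps a * (fps_exp 1 + 1) = 2 * fps_exp a"
proof (rule fps_expansion_unique_complex)
  \<comment> \<open>The quotient defining the Euler polynomials is analytic only up to the poles at \<open>\<plusminus> \<i> * pi\<close>,
    but identities of formal series need only a neighbourhood of \<open>0\<close>.\<close>
  have near_0: "\<forall>\<^sub>F t in nhds (0::complex). norm t < pi"
    using eventually_nhds_ball[of pi "0::complex"] by (simp add: dist_norm)
  have "(\<lambda>t. 2 * exp (a * t) / (exp t + 1)) has_fps_expansion euler_fps a"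
  proof (rule has_fps_expansionI)
    show "\<forall>\<^sub>F t in nhds 0. (\<lambda>n. fps_nth (euler_fps a) n * t ^ n) sums (2 * exp (a * t) / (exp t + 1))"
      using near_0
    proof eventually_elim
      case (elim t)
      then show ?case using euler_poly_sums[of t a] by (simp add: euler_fps_def)
    qed
  qed
  then have product: "(\<lambda>t. 2 * exp (a * t) / (exp t + 1) * (exp t + 1)) has_fps_expansion
      euler_fps a * (fps_exp 1 + 1)"
    by (intro fps_expansion_intros)
  have cancel: "\<forall>\<^sub>F t in nhds 0. 2 * exp (a * t) / (exp t + 1) * (exp t + 1) = 2 * exp (a * t)"
    using near_0 by eventually_elim (simp add: exp_plus_1_nonzero)
  show "(\<lambda>t. 2 * exp (a * t)) has_fps_expansion euler_fps a * (fps_exp 1 + 1)"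
    by (rule iffD1[OF has_fps_expansion_cong[OF cancel refl] product])
  show "(\<lambda>t. 2 * exp (a * t)) has_fps_expansion 2 * fps_exp a"
    by (intro fps_expansion_intros)
qed

lemma euler_fps_add_1: "euler_fps (a + 1) = euler_fps a * fps_exp 1"
proof -
  have "fps_nth (fps_exp 1 + 1 :: complex fps) 0 \<noteq> 0" by simp
  then have nz: "fps_exp 1 + 1 \<noteq> (0 :: complex fps)" by (metis fps_zero_nth)
  have "euler_fps (a + 1) * (fps_exp 1 + 1) = 2 * fps_exp a * fps_exp 1"
    by (simp add: euler_fps_mult fps_exp_add_mult mult.assoc)
  also have "\<dots> = euler_fps a * fps_exp 1 * (fps_exp 1 + 1)"
    unfolding euler_fps_mult[symmetric] by (simp add: mult_ac)
  finally show ?thesis using nz by simp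
qed

lemma euler_poly_functional_equation: "euler_poly n a + euler_poly n (a + 1) = 2 * a ^ n"
proof -
  have "euler_fps a + euler_fps (a + 1) = 2 * fps_exp a"
    by (simp add: euler_fps_add_1 flip: euler_fps_mult) (simp add: algebra_simps)
  then have "fps_nth (euler_fps a + euler_fps (a + 1)) n = fps_nth (2 * fps_exp a) n" by simp
  then show ?thesis
    by (simp add: euler_fps_def numeral_fps_const field_simps)
qed

text \<open>
  On generating functions, shifting \<open>a\<close> by \<open>1\<close> is multiplication by \<open>exp t\<close>, so \<open>N\<close> differences
  multiply by \<open>(1 - exp t) ^ N\<close>, a series that starts at \<open>t ^ N\<close>. This replaces an argument about the
  degree of \<open>E\<^sub>n\<close>.
\<close>

lemma decrement_pow_euler_poly_eq_0:
  assumes "n < N"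
  shows "(decrement ^^ N) (euler_poly n) a = 0"
proof -
  have "Abs_fps (\<lambda>n. (decrement ^^ N) (euler_poly n) a / fact n)
          = euler_fps a * (1 - fps_exp 1) ^ N" for N a
  proof (induction N arbitrary: a)
    case 0
    show ?case by (simp add: euler_fps_def)
  next
    case (Suc N)
    have "Abs_fps (\<lambda>n. (decrement ^^ Suc N) (euler_poly n) a / fact n)
        = Abs_fps (\<lambda>n. (decrement ^^ N) (euler_poly n) a / fact n)
          - Abs_fps (\<lambda>n. (decrement ^^ N) (euler_poly n) (a + 1) / fact n)"
      unfolding decrement_pow_Suc by (simp add: fps_eq_iff diff_divide_distrib)
    also have "\<dots> = euler_fps a * (1 - fps_exp 1) ^ Suc N"
      unfolding Suc.IH euler_fps_add_1 by (simp add: algebra_simps)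
    finally show ?case .
  qed
  then have "(decrement ^^ N) (euler_poly n) a / fact n
      = fps_nth (euler_fps a * (1 - fps_exp 1) ^ N) n"
    by (metis fps_nth_Abs_fps)
  also have "\<dots> = 0"
    unfolding fps_mult_nth using startsby_zero_power_prefix[of "1 - fps_exp (1::complex)" N] assms
    by (intro sum.neutral) auto
  finally show ?thesis by simp
qed

text \<open>
  This is \<open>z ^ m = (1 - \<Delta> / 2) E\<^sub>m\<close> with \<open>\<Delta> ^^ j\<close> applied to both sides. After division by
  \<open>2 ^ Suc j\<close> the right-hand side telescopes in \<open>j\<close>, and for \<open>j > m\<close> it vanishes.
\<close>

lemma decrement_pow_power:
  "(decrement ^^ j) (\<lambda>z. z ^ m) a
     = (decrement ^^ j) (euler_poly m) a - (decrement ^^ Suc j) (euler_poly m) a / 2"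
proof -
  have "(\<lambda>z. z ^ m) = (\<lambda>z. euler_poly m z - 1 / 2 * decrement (euler_poly m) z)"
  proof
    fix z
    show "z ^ m = euler_poly m z - 1 / 2 * decrement (euler_poly m) z"
      using euler_poly_functional_equation[of m z] by (simp add: decrement_def field_simps)
  qed
  then have "(decrement ^^ j) (\<lambda>z. z ^ m) a
      = (decrement ^^ j) (\<lambda>z. euler_poly m z - 1 / 2 * decrement (euler_poly m) z) a" by simp
  also have "\<dots> = (decrement ^^ j) (euler_poly m) a - 1 / 2 * (decrement ^^ j) (decrement (euler_poly m)) a"
    by (simp only: decrement_pow_diff decrement_pow_cmult)
  finally show ?thesis by (simp add: funpow_swap1)
qed

lemma base_nonzero:
  assumes "a \<notin> \<int>\<^sub>\<le>\<^sub>0"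
  shows "of_nat r + a \<noteq> (0 :: complex)"
  using assms by (metis add.commute plus_of_nat_eq_0_imp)

text \<open>
  With \<open>N = m + 1\<close> rounds the remaining series consists of vanishing differences, and the finite
  sum telescopes to its first term.
\<close>

lemma alt_hurwitz_neg_nat:
  assumes "a \<notin> \<int>\<^sub>\<le>\<^sub>0"
  shows "alt_hurwitz a (- of_nat m) = euler_poly m a / 2"
proof -
  define N where "N = Suc m"
  have powr: "(decrement ^^ j) (\<lambda>z. z powr (- (- of_nat m))) (of_nat r + a)
      = (decrement ^^ j) (\<lambda>z. z ^ m) (of_nat r + a)" for j r
  proof (rule decrement_pow_cong)
    fix i
    have "of_nat r + a + of_nat i \<noteq> 0"
      using base_nonzero[OF assms, of "r + i"] by (simp add: add_ac)
    then show "(of_nat r + a + of_nat i) powr (- (- of_nat m)) = (of_nat r + a + of_nat i) ^ m"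
      by simp
  qed
  have "eta_term a N (- of_nat m) r = 0" for r
    unfolding eta_term_def powr decrement_pow_power
    using decrement_pow_euler_poly_eq_0[of m N "of_nat r + a"]
      decrement_pow_euler_poly_eq_0[of m "Suc N" "of_nat r + a"] by (simp add: N_def)
  moreover have "alt_hurwitz a (- of_nat m) = eta_stage a N (- of_nat m)"
    by (rule alt_hurwitz_eq_eta_stage) (simp add: N_def)
  ultimately have "alt_hurwitz a (- of_nat m)
      = (\<Sum>j<N. (decrement ^^ j) (\<lambda>z. z powr (- (- of_nat m))) a / 2 ^ Suc j)"
    by (simp add: eta_stage_def)
  also have "\<dots> = (\<Sum>j<N. (decrement ^^ j) (euler_poly m) a / 2 ^ Suc j
      - (decrement ^^ Suc j) (euler_poly m) a / 2 ^ Suc (Suc j))"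
  proof (rule sum.cong)
    fix j
    show "(decrement ^^ j) (\<lambda>z. z powr (- (- of_nat m))) a / 2 ^ Suc j =
      (decrement ^^ j) (euler_poly m) a / 2 ^ Suc j
      - (decrement ^^ Suc j) (euler_poly m) a / 2 ^ Suc (Suc j)"
      using powr[of j 0] decrement_pow_power[of j m a] by (simp add: field_simps)
  qed simp
  also have "\<dots> = euler_poly m a / 2 - (decrement ^^ N) (euler_poly m) a / 2 ^ Suc N"
    by (subst sum_lessThan_telescope') simp
  also have "\<dots> = euler_poly m a / 2"
    using decrement_pow_euler_poly_eq_0[of m N a] by (simp add: N_def)
  finally show ?thesis .
qed

section \<open>The augmented triangular series\<close>

text \<open>
  Multiplying a principal power of \<open>w \<noteq> 0\<close> by an integer power of \<open>w\<close> just adds the exponents,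
  with no branch correction, so each power of \<open>r + a\<close> in the quadratic is absorbed as a shift of \<open>s\<close>.
\<close>

lemma H_term_decomposition:
  assumes "a \<notin> \<int>\<^sub>\<le>\<^sub>0"
  shows "H_term k s a r =
      alpha k * ((-1) ^ r * (of_nat r + a) powr (- (s - 2)))
      + (beta k - 2 * a * alpha k) * ((-1) ^ r * (of_nat r + a) powr (- (s - 1)))
      + (1 - a * beta k + a ^ 2 * alpha k) * ((-1) ^ r * (of_nat r + a) powr (- s))"
proof -
  define z where "z = of_nat r + a"
  have z: "z \<noteq> 0" using base_nonzero[OF assms] by (simp add: z_def)
  have "z powr (- (s - 2)) = z powr (- s + of_nat 2)" by (simp add: algebra_simps)
  also have "\<dots> = z ^ 2 * z powr (- s)"
    by (simp only: powr_add powr_complexpow[OF z] mult.commute)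
  finally have 2: "z powr (- (s - 2)) = z ^ 2 * z powr (- s)" .
  have "z powr (- (s - 1)) = z powr (- s + of_nat 1)" by (simp add: algebra_simps)
  also have "\<dots> = z ^ 1 * z powr (- s)"
    by (simp only: powr_add powr_complexpow[OF z] mult.commute)
  finally have 1: "z powr (- (s - 1)) = z * z powr (- s)" by simp
  have r: "of_nat r = z - a" by (simp add: z_def)
  have "H_term k s a r = (alpha k * (z - a) ^ 2 + beta k * (z - a) + 1) * (-1) ^ r * z powr (- s)"
    unfolding H_term_def A_Suc z_def[symmetric] unfolding r
    by (simp add: powr_minus divide_inverse)
  then show ?thesis
    unfolding z_def[symmetric] 1 2 by (simp add: algebra_simps power2_eq_square)
qed

lemma is_H_continuation_alt_hurwitz:
  assumes "a \<notin> \<int>\<^sub>\<le>\<^sub>0"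
  shows "is_H_continuation k a (\<lambda>s. alpha k * alt_hurwitz a (s - 2)
      + (beta k - 2 * a * alpha k) * alt_hurwitz a (s - 1)
      + (1 - a * beta k + a ^ 2 * alpha k) * alt_hurwitz a s)"
  unfolding is_H_continuation_def
proof (intro conjI allI impI)
  have shift: "(\<lambda>s. alt_hurwitz a (s - c)) holomorphic_on UNIV" for c
    using holomorphic_on_compose_gen[OF _ holomorphic_alt_hurwitz, of "\<lambda>s. s - c" UNIV]
    by (simp add: o_def holomorphic_intros)
  show "(\<lambda>s. alpha k * alt_hurwitz a (s - 2)
      + (beta k - 2 * a * alpha k) * alt_hurwitz a (s - 1)
      + (1 - a * beta k + a ^ 2 * alpha k) * alt_hurwitz a s) holomorphic_on UNIV"
    using shift[of 0] by (intro holomorphic_intros shift) simp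
  fix s :: complex assume "Re s > 2"
  then show "H_term k s a sums (alpha k * alt_hurwitz a (s - 2)
      + (beta k - 2 * a * alpha k) * alt_hurwitz a (s - 1)
      + (1 - a * beta k + a ^ 2 * alpha k) * alt_hurwitz a s)"
    unfolding H_term_decomposition[OF assms, abs_def]
    by (intro sums_add sums_mult alt_hurwitz_sums) simp_all
qed

lemma H_eqI:
  assumes "is_H_continuation k a F"
  shows "H k s a = F s"
proof -
  have "(THE F. is_H_continuation k a F) = F"
    using assms is_H_continuation_unique by (intro the_equality)
  then show ?thesis by (simp add: H_def)
qed

theorem theorem7p10:
  fixes k m :: nat and a :: complex
  assumes "a \<notin> \<int>\<^sub>\<le>\<^sub>0"
  shows "(\<exists>F. is_H_continuation k a F) \<and>
    H k (- of_nat m) a =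
      1 / 2 * alpha k * euler_poly (m + 2) a
      + 1 / 2 * (beta k - 2 * a * alpha k) * euler_poly (m + 1) a
      + 1 / 2 * (1 - a * beta k + a ^ 2 * alpha k) * euler_poly m a"
proof
  show "\<exists>F. is_H_continuation k a F"
    by (rule exI) (rule is_H_continuation_alt_hurwitz[OF assms])
  have "H k (- of_nat m) a = alpha k * alt_hurwitz a (- of_nat m - 2)
      + (beta k - 2 * a * alpha k) * alt_hurwitz a (- of_nat m - 1)
      + (1 - a * beta k + a ^ 2 * alpha k) * alt_hurwitz a (- of_nat m)"
    by (rule H_eqI[OF is_H_continuation_alt_hurwitz[OF assms]])
  moreover have "- of_nat m - 2 = (- of_nat (m + 2) :: complex)"
    and "- of_nat m - 1 = (- of_nat (m + 1) :: complex)" by simp_all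
  ultimately show "H k (- of_nat m) a =
      1 / 2 * alpha k * euler_poly (m + 2) a
      + 1 / 2 * (beta k - 2 * a * alpha k) * euler_poly (m + 1) a
      + 1 / 2 * (1 - a * beta k + a ^ 2 * alpha k) * euler_poly m a"
    by (simp only: alt_hurwitz_neg_nat[OF assms]) (simp add: algebra_simps)
qed

end
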